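(* Let $n$ and $l$ be positive integers. The height of the set of all words over an ordered alphabet of cardinality $l$ that are not $n$-divisible, relative to the set of words of length less than $n$, does not exceed $$\Phi(n,l) = E_1\, l\cdot n^{E_2+12\log_3 n},$$ where $E_1 = 4^{21\log_3 4 + 17}$ and $E_2 = 30\log_3 4 + 10$.
   Context: The alphabet $a_1\prec a_2\prec\dots\prec a_l$ is linearly ordered, and words are compared lexicographically; two words are incomparable if one of them is a beginning (prefix) of the other. Thus $u\succ v$ means that neither word is a prefix of the other and, at the first position where they differ, the letter of $u$ is greater than that of $v$. A word $W$ is $n$-divisible if it can be represented as a concatenation $W=vu_1u_2\cdots u_n$ with $u_1\succ u_2\succ\dots\succ u_n$. A set $M$ of words has height $h$ over a set of words $Y$ if $h$ is the minimal integer such that every word of $M$ can be represented as $u_{1}^{k_1}u_{2}^{k_2}\cdots u_{r}^{k_r}$ with all $u_{i}\in Y$ and $r\leqslant h$. *)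

theory Defs
  imports Complex_Main
begin

definition word_greater :: "'a::linorder list \<Rightarrow> 'a list \<Rightarrow> bool"  (infix "\<succ>" 50) where
  "u \<succ> v \<longleftrightarrow> (\<exists>p x y s t. u = p @ x # s \<and> v = p @ y # t \<and> y < x)"

definition n_divisible :: "nat \<Rightarrow> 'a::linorder list \<Rightarrow> bool" where
  "n_divisible n W \<longleftrightarrow>
     (\<exists>v us. length us = n \<and> W = v @ concat us \<and> successively (\<succ>) us)"

definition word_power :: "'a list \<Rightarrow> nat \<Rightarrow> 'a list" where
  "word_power u k = concat (replicate k u)"

text \<open>A pair \<open>(u, k)\<close> in the list \<open>ps\<close> stands for the factor \<open>u\<^sup>k\<close>.\<close>

definition power_product :: "'a list set \<Rightarrow> nat \<Rightarrow> 'a list \<Rightarrow> bool" where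
  "power_product Y h W \<longleftrightarrow>
     (\<exists>ps. length ps \<le> h \<and> (\<forall>(u, k) \<in> set ps. u \<in> Y) \<and>
           W = concat (map (\<lambda>(u, k). word_power u k) ps))"

text \<open>
  The height is a relation rather than a function: a set of words need not have a (finite)
  height over \<open>Y\<close>, so a bound on the height has to include its existence.
\<close>

definition has_height :: "'a list set \<Rightarrow> 'a list set \<Rightarrow> nat \<Rightarrow> bool" where
  "has_height M Y h \<longleftrightarrow>
     (\<forall>W \<in> M. power_product Y h W) \<and>
     (\<forall>h'. (\<forall>W \<in> M. power_product Y h' W) \<longrightarrow> h \<le> h')"

definition E1 :: real where
  "E1 = 4 powr (21 * log 3 4 + 17)"

definition E2 :: real where
  "E2 = 30 * log 3 4 + 10"

definition Phi :: "nat \<Rightarrow> nat \<Rightarrow> real" where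
  "Phi n l = E1 * real l * real n powr (E2 + 12 * log 3 (real n))"

end

theory Submission
  imports Defs
begin

text \<open>
  Let \<open>W\<close> be a word that is not \<open>n\<close>-divisible, and fix a length \<open>t\<close>. Disjoint factors of length
  \<open>t\<close> whose values decrease from left to right can be prolonged until they tile a suffix of \<open>W\<close>,
  and prolonging two words does not affect their comparison once they differ. So \<open>n\<close> such factors
  cannot exist. Colour each position by the length of the longest chain of disjoint decreasing
  \<open>t\<close>-factors that ends there. Fewer than \<open>n\<close> colours occur, and among positions of one colour the
  \<open>t\<close>-factor can decrease only between positions at distance less than \<open>t\<close>.

  Cut the word at the first and after the last occurrence of every pair of a colour and a
  \<open>t\<close>-factor. If an interval without inner cuts has more than \<open>t\<close> positions, every pair occurring
  in it occurs both at or before its beginning and at or after its end; two different factors of the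
  same colour would then give a decrease over a distance of at least \<open>t\<close>. Hence such an interval
  contains fewer than \<open>n\<close> different \<open>t\<close>-factors (\<open>cuts_exist\<close>). The number of cuts is at most
  \<open>2 (n - 1) q(t)\<close>, where \<open>q(t)\<close> is the number of different \<open>t\<close>-factors of \<open>W\<close>. This is used twice.

  A factor of length \<open>2t\<close> consists of two adjacent \<open>t\<close>-factors. For \<open>t < n\<close> an interval between
  cuts contributes at most \<open>(n - 1)\<^sup>2\<close> words from pairs inside it and \<open>t\<close> from pairs that cross its
  right end, which gives \<open>q(2t) \<le> 2 n\<^sup>3 q(t)\<close> (\<open>complexity_double\<close>). Starting from \<open>q(1) \<le> l\<close>,
  about \<open>log\<^sub>2 n\<close> doublings reach a length \<open>T\<close> with \<open>n \<le> T \<le> 2 (n - 1)\<close>, and the complexity there is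
  linear in \<open>l\<close> and at most \<open>n\<close> to a power of order \<open>log n\<close>.

  At this length an interval between cuts either is so short that two words of length less than \<open>n\<close>
  cover it, or has fewer than \<open>n \<le> T\<close> different \<open>T\<close>-factors. In the latter case the argument of Morse
  and Hedlund makes it periodic with period less than \<open>n\<close> after a beginning shorter than \<open>n\<close>
  (\<open>low_complexity_periodic\<close>), so it is a product of three powers of words of length less than
  \<open>n\<close>. The height is therefore at most three times the number of intervals, plus two for the last
  \<open>T - 1\<close> letters, and this is smaller than \<open>Phi n l\<close>.
\<close>

section \<open>Disjoint decreasing factors\<close>

lemma word_greater_append: "u \<succ> v \<Longrightarrow> u @ u' \<succ> v @ v'"
  unfolding word_greater_def by fastforce

text \<open>The witnessing difference lies within the first \<open>t\<close> letters, so it survives in the whole words.\<close>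

lemma word_greater_take:
  assumes "take t u \<succ> take t v"
  shows "u \<succ> v"
  using word_greater_append[OF assms, of "drop t u" "drop t v"] by simp

lemma word_greater_total:
  assumes "length u = length v" "u \<noteq> v"
  shows "u \<succ> v \<or> v \<succ> u"
  using assms
proof (induction u v rule: list_induct2)
  case Nil
  then show ?case by simp
next
  case (Cons x u y v)
  consider "y < x" | "x < y" | "x = y" by (rule linorder_cases)
  then show ?case
  proof cases
    case 1
    have "x # u = [] @ x # u" "y # v = [] @ y # v" by simp_all
    with 1 show ?thesis unfolding word_greater_def by blast
  next
    case 2
    have "x # u = [] @ x # u" "y # v = [] @ y # v" by simp_all
    with 2 show ?thesis unfolding word_greater_def by blast
  next
    case 3
    have "x # u \<succ> x # v" if "u \<succ> v" for u v
      using that unfolding word_greater_def by (metis append_Cons)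
    with 3 Cons show ?thesis by auto
  qed
qed

definition factor :: "'a list \<Rightarrow> nat \<Rightarrow> nat \<Rightarrow> 'a list" where
  "factor W i t = take t (drop i W)"

lemma length_factor: "i + t \<le> length W \<Longrightarrow> length (factor W i t) = t"
  by (simp add: factor_def)

lemma factor_add: "factor W i (s + t) = factor W i s @ factor W (i + s) t"
  by (simp add: factor_def take_add add.commute)

lemma factor_join: "s \<le> b \<Longrightarrow> b \<le> e \<Longrightarrow> factor W s (b - s) @ factor W b (e - b) = factor W s (e - s)"
  using factor_add[of W s "b - s" "e - b"] by simp

text \<open>The gap \<open>i + t \<le> j\<close> makes the two compared factors disjoint, so that both fit into consecutive
  blocks of a division of \<open>W\<close>.\<close>

definition descent :: "'a::linorder list \<Rightarrow> nat \<Rightarrow> nat \<Rightarrow> nat \<Rightarrow> bool" where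
  "descent W t i j \<longleftrightarrow> i + t \<le> j \<and> j + t \<le> length W \<and> factor W i t \<succ> factor W j t"

text \<open>Cutting the suffix at the positions of the chain gives blocks of length at least \<open>t\<close>, each of
  which begins with the factor at its position; these beginnings decide the comparisons. The last
  conjunct lets the induction compare a new first block with its successor.\<close>

lemma descents_cut_suffix:
  assumes "successively (descent W t) (i # js)"
  shows "\<exists>us. length us = length (i # js) \<and> drop i W = concat us \<and> successively (\<succ>) us \<and>
           take t (hd us) = factor W i t"
  using assms
proof (induction js arbitrary: i)
  case Nil
  show ?case by (rule exI[of _ "[drop i W]"]) (simp add: factor_def)
next
  case (Cons j js)
  then have ij: "descent W t i j" and "successively (descent W t) (j # js)" by simp_all
  from Cons.IH[OF this(2)] obtain us where us: "length us = length (j # js)"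
    "drop j W = concat us" "successively (\<succ>) us" "take t (hd us) = factor W j t"
    by blast
  from us(1) obtain u us' where us': "us = u # us'" by (cases us) auto
  let ?v = "take (j - i) (drop i W)"
  from ij have le: "i + t \<le> j" and gr: "factor W i t \<succ> factor W j t"
    by (auto simp: descent_def)
  have v: "take t ?v = factor W i t" using le by (simp add: factor_def min_def)
  have "drop (j - i) (drop i W) = drop j W" using le by simp
  then have "drop i W = concat (?v # us)"
    using append_take_drop_id[of "j - i" "drop i W"] us(2) by (simp only: concat.simps)
  moreover have "?v \<succ> u"
    by (rule word_greater_take[of t]) (use v gr us(4) us' in \<open>simp only: list.sel\<close>)
  then have "successively (\<succ>) (?v # us)" using us(3) us' by simp
  ultimately show ?case
    using us(1) v by (intro exI[of _ "?v # us"] conjI) (simp_all only: list.sel length_Cons)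
qed

lemma n_divisible_if_descents:
  assumes "successively (descent W t) js" "length js = n" "n > 0"
  shows "n_divisible n W"
proof -
  from assms obtain i ks where js: "js = i # ks" by (cases js) auto
  from descents_cut_suffix[of W t i ks] assms js obtain us where us:
    "length us = n" "drop i W = concat us" "successively (\<succ>) us" by auto
  have "W = take i W @ concat us" by (simp flip: us(2))
  with us(1,3) show ?thesis
    unfolding n_divisible_def by (intro exI[of _ "take i W"] exI[of _ us] conjI)
qed

lemma successively_take: "successively P xs \<Longrightarrow> successively P (take n xs)"
  using successively_append_iff[of P "take n xs" "drop n xs"] by simp

lemma descents_short:
  assumes "\<not> n_divisible n W" "n > 0" "successively (descent W t) js"
  shows "length js < n"
proof (rule ccontr)
  assume "\<not> length js < n"
  then have "length (take n js) = n" by simp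
  with n_divisible_if_descents[OF successively_take[OF assms(3)]] assms(1,2) show False by blast
qed

section \<open>Colouring the positions\<close>

text \<open>Each point is coloured by the length of the longest \<open>R\<close>-chain ending there; an \<open>R\<close>-step prolongs
  such a chain. For a strict order this is Mirsky's dual of Dilworth's theorem.\<close>

lemma rank_colouring:
  fixes R :: "'b \<Rightarrow> 'b \<Rightarrow> bool"
  assumes "\<And>js. successively R js \<Longrightarrow> length js < n"
  shows "\<exists>c. (\<forall>x. c x \<in> {1..<n}) \<and> (\<forall>x y. R x y \<longrightarrow> c x < c y)"
proof -
  define L where "L x = {length (js @ [x]) | js. successively R (js @ [x])}" for x
  have bounded: "L x \<subseteq> {1..<n}" for x
  proof
    fix k assume "k \<in> L x"
    then obtain js where "k = length (js @ [x])" "successively R (js @ [x])"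
      unfolding L_def by blast
    with assms[of "js @ [x]"] show "k \<in> {1..<n}" by simp
  qed
  then have fin: "finite (L x)" for x by (meson finite_atLeastLessThan finite_subset)
  have "1 \<in> L x" for x unfolding L_def by (rule CollectI, rule exI[of _ "[]"]) simp
  then have mem: "Max (L x) \<in> L x" for x using fin Max_in by (metis empty_iff)
  have "Max (L x) < Max (L y)" if "R x y" for x y
  proof -
    from mem[of x] obtain js where js: "Max (L x) = length (js @ [x])" "successively R (js @ [x])"
      unfolding L_def by blast
    then have "successively R ((js @ [x]) @ [y])"
      using that by (subst successively_append_iff) simp
    then have "length ((js @ [x]) @ [y]) \<in> L y" unfolding L_def by blast
    then have "Suc (Max (L x)) \<le> Max (L y)" using js fin by (intro Max_ge) auto
    then show ?thesis by simp
  qed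
  with mem bounded show ?thesis by (intro exI[of _ "\<lambda>x. Max (L x)"]) blast
qed

text \<open>The subword complexity of \<open>W\<close>. Its index set consists of the positions \<open>i\<close> with \<open>i + t \<le> length W\<close>,
  so only factors of full length are counted.\<close>

definition complexity :: "'a list \<Rightarrow> nat \<Rightarrow> nat" where
  "complexity W t = card ((\<lambda>i. factor W i t) ` {..<Suc (length W) - t})"

lemma card_image_determined:
  assumes "finite S" "\<And>x y. x \<in> S \<Longrightarrow> y \<in> S \<Longrightarrow> c x = c y \<Longrightarrow> f x = f y"
  shows "card (f ` S) \<le> card (c ` S)"
proof -
  have "f ` S = (\<lambda>k. f (inv_into S c k)) ` c ` S"
    unfolding image_image
    by (intro image_cong refl assms(2)) (auto simp: f_inv_into_f inv_into_into)
  then show ?thesis using assms(1) by (metis card_image_le finite_imageI)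
qed

text \<open>The central step. The cuts are the first positions and the successors of the last positions of the
  pairs \<open>h i\<close> of colour and factor. In an interval longer than \<open>t\<close> without inner cuts the colour
  determines the factor, because each pair present there also occurs on or beyond either side of the
  interval, far enough apart to form a descent.\<close>

lemma cuts_exist:
  fixes W :: "'a::linorder list"
  assumes "\<not> n_divisible n W" "n > 0"
  shows "\<exists>B. finite B \<and> card B \<le> 2 * (n - 1) * complexity W t \<and>
    (\<forall>s e. e + t \<le> Suc (length W) \<longrightarrow> s + t < e \<longrightarrow> B \<inter> {s<..<e} = {} \<longrightarrow>
       card ((\<lambda>i. factor W i t) ` {s..<e}) < n)"
proof -
  define m where "m = Suc (length W) - t"
  let ?f = "\<lambda>i. factor W i t"
  obtain c where c: "\<And>x. c x \<in> {1..<n}" "\<And>x y. descent W t x y \<Longrightarrow> c x < c y"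
    using rank_colouring[of "descent W t" n] descents_short[OF assms] by metis
  define h where "h i = (c i, ?f i)" for i
  define K where "K = h ` {..<m}"
  define occ where "occ k = {i. i < m \<and> h i = k}" for k
  define B where "B = (\<lambda>k. Min (occ k)) ` K \<union> (\<lambda>k. Suc (Max (occ k))) ` K"
  have finK: "finite K" by (simp add: K_def)
  have finocc: "finite (occ k)" for k by (simp add: occ_def)
  have "K \<subseteq> {1..<n} \<times> ?f ` {..<m}" using c(1) by (auto simp: K_def h_def)
  then have "card K \<le> card ({1..<n} \<times> ?f ` {..<m})" by (intro card_mono) auto
  also have "\<dots> = (n - 1) * complexity W t"
    by (simp add: card_cartesian_product complexity_def m_def)
  finally have "card K \<le> (n - 1) * complexity W t" .
  moreover have "card B \<le> card K + card K"
    unfolding B_def by (rule order_trans[OF card_Un_le]) (intro add_mono card_image_le finK)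
  ultimately have cardB: "card B \<le> 2 * (n - 1) * complexity W t" by simp
  have finB: "finite B" using finK by (simp add: B_def)
  have few: "card (?f ` {s..<e}) < n"
    if e: "e + t \<le> Suc (length W)" and long: "s + t < e" and free: "B \<inter> {s<..<e} = {}" for s e
  proof -
    have em: "e \<le> m" using e by (simp add: m_def)
    have absurd: False
      if x: "x \<in> {s..<e}" and y: "y \<in> {s..<e}" and cxy: "c x = c y" and gr: "?f x \<succ> ?f y"
      for x y
    proof -
      \<comment> \<open>The interval contains no cut, so the larger factor is already present at or before its
        first position, and the smaller one at or after its last position.\<close>
      define i where "i = Min (occ (h x))"
      define j where "j = Max (occ (h y))"
      have xo: "x \<in> occ (h x)" and yo: "y \<in> occ (h y)" using x y em by (auto simp: occ_def)
      have io: "i \<in> occ (h x)" unfolding i_def by (rule Min_in[OF finocc]) (use xo in blast)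
      have jo: "j \<in> occ (h y)" unfolding j_def by (rule Max_in[OF finocc]) (use yo in blast)
      have "i \<le> x" unfolding i_def by (rule Min_le[OF finocc xo])
      have "y \<le> j" unfolding j_def by (rule Max_ge[OF finocc yo])
      have "h x \<in> K" "h y \<in> K" using x y em by (auto simp: K_def)
      then have "i \<in> B" "Suc j \<in> B" unfolding B_def i_def j_def by blast+
      then have "i \<notin> {s<..<e}" "Suc j \<notin> {s<..<e}" using free by blast+
      with \<open>i \<le> x\<close> \<open>y \<le> j\<close> x y have "i \<le> s" "e \<le> Suc j" by auto
      with long have "i + t \<le> j" by simp
      moreover from io jo gr have "?f i \<succ> ?f j" "j < m" "c i = c j"
        using cxy by (auto simp: occ_def h_def)
      ultimately have "descent W t i j" by (auto simp: descent_def m_def)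
      with c(2) \<open>c i = c j\<close> show False by fastforce
    qed
    have "card (?f ` {s..<e}) \<le> card (c ` {s..<e})"
    proof (rule card_image_determined)
      fix x y assume xy: "x \<in> {s..<e}" "y \<in> {s..<e}" "c x = c y"
      have "length (?f x) = length (?f y)"
        using xy e by (simp add: length_factor)
      with absurd[OF xy] absurd[OF xy(2,1) xy(3)[symmetric]] word_greater_total
      show "?f x = ?f y" by blast
    qed simp
    also have "\<dots> \<le> card {1..<n}" using c(1) by (intro card_mono) auto
    finally show ?thesis using assms(2) by simp
  qed
  show ?thesis
    by (rule exI[of _ B]) (use finB cardB few in blast)
qed

section \<open>Subword complexity\<close>

text \<open>Additive bounds pass from intervals without inner cuts to the whole range; it is used both for
  counting factors and for collecting powers.\<close>

lemma interval_cut_induct: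
  fixes m :: nat
  assumes "finite B"
    and base: "\<And>s e. s \<le> e \<Longrightarrow> e \<le> m \<Longrightarrow> B \<inter> {s<..<e} = {} \<Longrightarrow> P s e (1::nat)"
    and join: "\<And>s b e x y. s \<le> b \<Longrightarrow> b \<le> e \<Longrightarrow> P s b x \<Longrightarrow> P b e y \<Longrightarrow> P s e (x + y)"
  shows "P 0 m (card (B \<inter> {0<..<m}) + 1)"
proof -
  have "P 0 j (card (B \<inter> {0<..<j}) + 1)" if "j \<le> m" for j
    using that
  proof (induction j rule: less_induct)
    case (less j)
    show ?case
    proof (cases "B \<inter> {0<..<j} = {}")
      case True
      with base[of 0 j] less.prems show ?thesis by simp
    next
      case False
      define b where "b = Max (B \<inter> {0<..<j})"
      have bin: "b \<in> B \<inter> {0<..<j}" unfolding b_def using False assms(1) by (intro Max_in) auto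
      have ge: "x \<le> b" if "x \<in> B \<inter> {0<..<j}" for x
        unfolding b_def using that assms(1) by (intro Max_ge) auto
      have split: "B \<inter> {0<..<j} = insert b (B \<inter> {0<..<b})"
        using bin ge by (force simp: le_less)
      have "card (B \<inter> {0<..<j}) = card (B \<inter> {0<..<b}) + 1"
        unfolding split using assms(1) by simp
      moreover have "B \<inter> {b<..<j} = {}" using ge by fastforce
      then have "P b j 1" using bin less.prems by (intro base) auto
      moreover have "P 0 b (card (B \<inter> {0<..<b}) + 1)" using bin less by auto
      ultimately show ?thesis
        using join[of 0 b j "card (B \<inter> {0<..<b}) + 1" 1] bin by simp
    qed
  qed
  then show ?thesis by simp
qed

text \<open>In an interval without inner cuts, the first half of a \<open>2t\<close>-factor starts inside, and so does the
  second half unless the factor starts at one of the last \<open>t\<close> positions. This gives at most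
  \<open>(n - 1)\<^sup>2 + t\<close> values, and \<open>t < n\<close> makes that at most \<open>n\<^sup>2\<close>.\<close>

lemma complexity_double:
  fixes W :: "'a::linorder list"
  assumes "\<not> n_divisible n W" "n > 0" "t < n"
  shows "complexity W (2 * t) \<le> 2 * n ^ 3 * complexity W t"
proof (cases "2 * t \<le> length W")
  case False
  then show ?thesis by (simp add: complexity_def)
next
  case True
  define N where "N = (n - 1)\<^sup>2 + t"
  define q where "q = complexity W t"
  let ?f = "\<lambda>t i. factor W i t"
  obtain B where B: "finite B" "card B \<le> 2 * (n - 1) * q"
    "\<And>s e. e + t \<le> Suc (length W) \<Longrightarrow> s + t < e \<Longrightarrow> B \<inter> {s<..<e} = {} \<Longrightarrow>
       card (?f t ` {s..<e}) < n"
    using cuts_exist[OF assms(1,2), of t] unfolding q_def by blast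
  define m where "m = Suc (length W) - 2 * t"
  have "complexity W (2*t) = card (?f (2*t) ` {0..<m})"
    by (simp add: complexity_def m_def atLeast0LessThan)
  also have "\<dots> \<le> N * (card (B \<inter> {0<..<m}) + 1)"
  proof (rule interval_cut_induct[OF B(1), where P = "\<lambda>s e k. card (?f (2*t) ` {s..<e}) \<le> N * k"])
    fix s e :: nat
    assume "s \<le> e" and em: "e \<le> m" and free: "B \<inter> {s<..<e} = {}"
    have "card (?f (2*t) ` {s..<e - t}) \<le> (n - 1)\<^sup>2"
    proof (cases "s + t < e")
      case False
      then show ?thesis by simp
    next
      case long: True
      let ?F = "?f t ` {s..<e}"
      have "card ?F < n" using B(3)[OF _ long free] em True by (simp add: m_def)
      have "?f (2*t) ` {s..<e - t} \<subseteq> (\<lambda>(u, v). u @ v) ` (?F \<times> ?F)"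
      proof (rule image_subsetI)
        fix i assume "i \<in> {s..<e - t}"
        then have "(?f t i, ?f t (i + t)) \<in> ?F \<times> ?F" by auto
        then show "?f (2*t) i \<in> (\<lambda>(u, v). u @ v) ` (?F \<times> ?F)"
          by (rule rev_image_eqI) (simp add: factor_add mult_2)
      qed
      then have "card (?f (2*t) ` {s..<e - t}) \<le> card (?F \<times> ?F)"
        by (meson card_image_le card_mono finite_SigmaI finite_atLeastLessThan finite_imageI
            le_trans)
      also have "\<dots> = (card ?F)\<^sup>2" by (simp add: card_cartesian_product power2_eq_square)
      also have "\<dots> \<le> (n - 1)\<^sup>2" using \<open>card ?F < n\<close> by (intro power_mono) auto
      finally show ?thesis .
    qed
    moreover have "card (?f (2*t) ` {e - t..<e}) \<le> t"
      by (rule order_trans[OF card_image_le]) auto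
    moreover have "?f (2*t) ` {s..<e} \<subseteq> ?f (2*t) ` {s..<e - t} \<union> ?f (2*t) ` {e - t..<e}" by force
    then have "card (?f (2*t) ` {s..<e}) \<le>
        card (?f (2*t) ` {s..<e - t}) + card (?f (2*t) ` {e - t..<e})"
      by (meson card_Un_le card_mono finite_UnI finite_atLeastLessThan finite_imageI le_trans)
    ultimately show "card (?f (2*t) ` {s..<e}) \<le> N * 1" by (simp add: N_def)
  next
    fix s b e x y :: nat
    assume "s \<le> b" "b \<le> e" and *: "card (?f (2*t) ` {s..<b}) \<le> N * x"
      "card (?f (2*t) ` {b..<e}) \<le> N * y"
    then have "?f (2*t) ` {s..<e} = ?f (2*t) ` {s..<b} \<union> ?f (2*t) ` {b..<e}"
      by (simp add: image_Un[symmetric] ivl_disj_un)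
    with card_Un_le[of "?f (2*t) ` {s..<b}" "?f (2*t) ` {b..<e}"] *
    show "card (?f (2*t) ` {s..<e}) \<le> N * (x + y)" by (simp add: algebra_simps)
  qed
  also have "\<dots> \<le> N * (2 * (n - 1) * q + 1)"
  proof (intro mult_le_mono2 add_right_mono)
    have "card (B \<inter> {0<..<m}) \<le> card B" using B(1) by (intro card_mono) auto
    with B(2) show "card (B \<inter> {0<..<m}) \<le> 2 * (n - 1) * q" by (rule order_trans[rotated])
  qed
  also have "\<dots> \<le> n\<^sup>2 * (2 * n * q)"
  proof (rule mult_mono)
    obtain k where k: "n = Suc k" using assms(2) by (cases n) auto
    show "N \<le> n\<^sup>2" using assms(3) by (simp add: N_def k power2_eq_square)
    have "q > 0" using True by (simp add: q_def complexity_def card_gt_0_iff lessThan_empty_iff)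
    then show "2 * (n - 1) * q + 1 \<le> 2 * n * q" by (simp add: k)
  qed auto
  finally show ?thesis by (simp add: q_def power2_eq_square power3_eq_cube)
qed

lemma complexity_one:
  assumes "W \<in> lists A" "finite A"
  shows "complexity W 1 \<le> card A"
proof -
  have "(\<lambda>i. factor W i 1) ` {..<length W} \<subseteq> (\<lambda>a. [a]) ` A"
  proof (rule image_subsetI)
    fix i assume "i \<in> {..<length W}"
    then have "factor W i 1 = [W ! i]" and "W ! i \<in> A"
      using assms(1) by (auto simp: factor_def take_Suc hd_drop_conv_nth)
    then show "factor W i 1 \<in> (\<lambda>a. [a]) ` A" by simp
  qed
  then have "card ((\<lambda>i. factor W i 1) ` {..<length W}) \<le> card ((\<lambda>a. [a]) ` A)"
    using assms(2) by (intro card_mono) auto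
  also have "\<dots> \<le> card A" using assms(2) by (rule card_image_le)
  finally show ?thesis by (simp add: complexity_def)
qed

lemma complexity_power_of_two:
  fixes W :: "'a::linorder list"
  assumes "\<not> n_divisible n W" "W \<in> lists A" "finite A" "2 ^ k < n"
  shows "complexity W (2 ^ Suc k) \<le> card A * (2 * n ^ 3) ^ Suc k"
  using assms(4)
proof (induction k)
  case 0
  then show ?case
    using order_trans[OF complexity_double[OF assms(1), of 1]
        mult_le_mono2[OF complexity_one[OF assms(2,3)], of "2 * n ^ 3"]]
    by (simp add: mult.commute)
next
  case (Suc k)
  have "(2::nat) ^ k < n" using Suc.prems by simp
  then have "2 * n ^ 3 * complexity W (2 ^ Suc k) \<le> 2 * n ^ 3 * (card A * (2 * n ^ 3) ^ Suc k)"
    by (intro mult_le_mono2 Suc.IH)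
  moreover have "complexity W (2 ^ Suc (Suc k)) \<le> 2 * n ^ 3 * complexity W (2 ^ Suc k)"
    using complexity_double[OF assms(1), of "2 ^ Suc k"] Suc.prems by simp
  ultimately show ?case by (simp add: mult.commute mult.left_commute)
qed

section \<open>Factors of low complexity\<close>

lemma power_product_append:
  assumes "power_product Y g U" "power_product Y h V"
  shows "power_product Y (g + h) (U @ V)"
proof -
  from assms obtain ps rs where
    "length ps \<le> g" "\<forall>(u, k) \<in> set ps. u \<in> Y" "U = concat (map (\<lambda>(u, k). word_power u k) ps)"
    "length rs \<le> h" "\<forall>(u, k) \<in> set rs. u \<in> Y" "V = concat (map (\<lambda>(u, k). word_power u k) rs)"
    unfolding power_product_def by blast
  then show ?thesis unfolding power_product_def by (intro exI[of _ "ps @ rs"]) auto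
qed

lemma power_product_mono: "power_product Y g U \<Longrightarrow> g \<le> h \<Longrightarrow> power_product Y h U"
  unfolding power_product_def
  by (erule exE, rule exI, erule conjE, rule conjI, erule order_trans)

lemma power_product_power: "u \<in> Y \<Longrightarrow> power_product Y 1 (word_power u k)"
  unfolding power_product_def by (intro exI[of _ "[(u, k)]"]) simp

lemma power_product_word: "u \<in> Y \<Longrightarrow> power_product Y 1 u"
  using power_product_power[of u Y 1] by (simp add: word_power_def)

abbreviation short_words :: "'a set \<Rightarrow> nat \<Rightarrow> 'a list set" where
  "short_words A n \<equiv> {u \<in> lists A. length u < n}"

lemma in_lists_take_drop: "u \<in> lists A \<Longrightarrow> take k u \<in> lists A \<and> drop k u \<in> lists A"
  by (metis append_in_lists_conv append_take_drop_id)

lemma factor_in_lists: "W \<in> lists A \<Longrightarrow> factor W i t \<in> lists A"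
  using in_lists_take_drop[of W A i] in_lists_take_drop[of "drop i W" A t]
  unfolding factor_def by blast

lemma power_product_two:
  assumes "u \<in> lists A" "length u \<le> 2 * (n - 1)" "n > 0"
  shows "power_product (short_words A n) 2 u"
proof -
  have "power_product (short_words A n) (1 + 1) (take (n - 1) u @ drop (n - 1) u)"
    using assms in_lists_take_drop[of u A "n - 1"]
    by (intro power_product_append power_product_word) auto
  then show ?thesis by (simp only: append_take_drop_id one_add_one)
qed

text \<open>Peel off one period at a time. The recursion ends when less than two periods are left: what
  remains after one more is shorter than \<open>g\<close>, so its prefix of length \<open>g\<close> is not the period.\<close>

lemma periodic_word:
  assumes "g > 0" "\<And>i. i + g < length v \<Longrightarrow> v ! i = v ! (i + g)"
  shows "\<exists>k r. v = word_power (take g v) k @ r \<and> length r < g"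
  using assms(2)
proof (induction v rule: length_induct)
  case (1 v)
  consider "length v < g" | "g \<le> length v" "length v < 2 * g" | "2 * g \<le> length v" by linarith
  then show ?case
  proof cases
    case 1
    then show ?thesis by (intro exI[of _ 0] exI[of _ v]) (simp add: word_power_def)
  next
    case 2
    then show ?thesis by (intro exI[of _ 1] exI[of _ "drop g v"]) (auto simp: word_power_def)
  next
    case 3
    let ?w = "drop g v"
    have "?w ! i = ?w ! (i + g)" if "i + g < length ?w" for i
      using that 1(2)[of "g + i"] by (simp add: ac_simps)
    moreover have "length ?w < length v" using assms(1) 3 by simp
    ultimately obtain k r where kr: "?w = word_power (take g ?w) k @ r" "length r < g"
      using 1(1) by blast
    have "take g ?w = take g v"
      using 3 1(2) by (intro nth_equalityI) (auto simp: add.commute)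
    with kr have "?w = word_power (take g v) k @ r" by simp
    then have "v = word_power (take g v) (Suc k) @ r"
      using append_take_drop_id[of g v] by (simp add: word_power_def)
    with kr(2) show ?thesis by blast
  qed
qed

lemma power_product_periodic:
  assumes "v \<in> lists A" "0 < g" "g < n" "\<And>i. i + g < length v \<Longrightarrow> v ! i = v ! (i + g)"
  shows "power_product (short_words A n) 2 v"
proof -
  from periodic_word[OF assms(2,4)] obtain k r where kr: "v = word_power (take g v) k @ r" "length r < g"
    by blast
  have "r \<in> lists A" using assms(1) kr(1) by (metis append_in_lists_conv)
  then have "power_product (short_words A n) (1 + 1) (word_power (take g v) k @ r)"
    using assms kr(2) in_lists_take_drop[OF assms(1), of g]
    by (intro power_product_append power_product_word power_product_power) auto
  then show ?thesis by (simp only: kr(1)[symmetric] one_add_one)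
qed

text \<open>A sequence that starts positive and grows at every step exceeds \<open>T\<close> after \<open>T\<close> steps.\<close>

lemma card_stalls:
  fixes q :: "nat \<Rightarrow> nat"
  assumes "\<And>r. r < T \<Longrightarrow> q r \<le> q (Suc r)" "0 < q 0" "q T \<le> T"
  shows "\<exists>r<T. q r = q (Suc r)"
proof (rule ccontr)
  assume no: "\<not> ?thesis"
  have "r < q r" if "r \<le> T" for r
    using that
  proof (induction r)
    case 0
    then show ?case using assms(2) by simp
  next
    case (Suc r)
    then have "q r \<noteq> q (Suc r)" using no by (metis Suc_le_eq)
    with Suc assms(1)[of r] show ?case by simp
  qed
  with assms(3) show False by (meson leD order_refl)
qed

lemma factor_prefix: "take r (factor W i (Suc r)) = factor W i r"
  by (simp add: factor_def)

lemma factor_suffix: "drop 1 (factor W i (Suc r)) = factor W (Suc i) r"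
  by (simp add: factor_def drop_take)

text \<open>The number of \<open>r\<close>-factors in the interval is nondecreasing in \<open>r\<close> and at most \<open>T\<close> for \<open>r = T\<close>, so
  it agrees for some \<open>r\<close> and \<open>Suc r\<close>; then every \<open>r\<close>-factor has a unique continuation by one letter.\<close>

lemma low_complexity_determines:
  assumes few: "card ((\<lambda>i. factor W i T) ` {s..<e}) \<le> T" and "s < e"
  shows "\<exists>r<T. \<forall>i\<in>{s..<e}. \<forall>j\<in>{s..<e}.
    factor W i r = factor W j r \<longrightarrow> factor W i (Suc r) = factor W j (Suc r)"
proof -
  let ?F = "\<lambda>r. (\<lambda>i. factor W i r) ` {s..<e}"
  have proj: "take r ` ?F (Suc r) = ?F r" for r by (simp add: image_image factor_prefix)
  have "card (?F r) \<le> card (?F (Suc r))" for r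
    using card_image_le[of "?F (Suc r)" "take r"] by (simp add: proj)
  moreover have "0 < card (?F 0)" using assms(2) by (simp add: card_gt_0_iff)
  ultimately obtain r where r: "r < T" "card (?F r) = card (?F (Suc r))"
    using card_stalls[of T "\<lambda>r. card (?F r)"] few by blast
  then have "inj_on (take r) (?F (Suc r))" by (intro eq_card_imp_inj_on) (auto simp: proj)
  then have "factor W i (Suc r) = factor W j (Suc r)"
    if "i \<in> {s..<e}" "j \<in> {s..<e}" "factor W i r = factor W j r" for i j
    by (rule inj_onD) (use that in \<open>simp_all add: factor_prefix\<close>)
  with r(1) show ?thesis by blast
qed

text \<open>Morse and Hedlund: among the first \<open>n\<close> positions two carry the same \<open>r\<close>-factor, and since an
  \<open>r\<close>-factor determines the next letter and hence the next \<open>r\<close>-factor, the word repeats from there on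
  with the distance of the two positions as period.\<close>

lemma low_complexity_periodic:
  assumes few: "card ((\<lambda>i. factor W i T) ` {s..<e}) < n" and "n \<le> Suc T" and long: "s + T < e"
    and eW: "e \<le> length W"
  shows "\<exists>i g. s \<le> i \<and> i + g < s + n \<and> 0 < g \<and> (\<forall>x. i \<le> x \<longrightarrow> x + g < e \<longrightarrow> W ! x = W ! (x + g))"
proof -
  obtain r where r: "r < T" and step: "\<And>i j. i \<in> {s..<e} \<Longrightarrow> j \<in> {s..<e} \<Longrightarrow>
      factor W i r = factor W j r \<Longrightarrow> factor W i (Suc r) = factor W j (Suc r)"
  proof -
    have "card ((\<lambda>i. factor W i T) ` {s..<e}) \<le> T" "s < e" using few assms(2) long by simp_all
    from low_complexity_determines[OF this] that show thesis by blast
  qed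
  let ?f = "\<lambda>i. factor W i r"
  have sub: "{s..<s + n} \<subseteq> {s..<e}" using assms(2) long by auto
  have "?f ` {s..<e} = take r ` (\<lambda>i. factor W i T) ` {s..<e}"
    using r by (simp add: image_image factor_def min_def)
  then have "card (?f ` {s..<e}) \<le> card ((\<lambda>i. factor W i T) ` {s..<e})"
    by (simp add: card_image_le)
  moreover have "card (?f ` {s..<s + n}) \<le> card (?f ` {s..<e})"
    using sub by (intro card_mono image_mono) auto
  ultimately have "card (?f ` {s..<s + n}) < card {s..<s + n}" using few by simp
  then have "\<not> inj_on ?f {s..<s + n}" by (rule pigeonhole)
  then obtain i j where ij: "s \<le> i" "i < j" "j < s + n" "?f i = ?f j"
    unfolding inj_on_def by (metis atLeastLessThan_iff linorder_neqE_nat)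
  have eq: "?f (i + h) = ?f (j + h)" if "j + h < e" for h
    using that
  proof (induction h)
    case 0
    then show ?case using ij by simp
  next
    case (Suc h)
    then have "factor W (i + h) (Suc r) = factor W (j + h) (Suc r)"
      using ij by (intro step) auto
    then show ?case using factor_suffix by (metis add_Suc_right)
  qed
  have "W ! x = W ! (x + (j - i))" if "i \<le> x" "x + (j - i) < e" for x
  proof -
    define h where "h = x - i"
    have x: "x = i + h" "x + (j - i) = j + h" using that(1) ij(2) by (auto simp: h_def)
    have "factor W (i + h) (Suc r) = factor W (j + h) (Suc r)"
      using eq[of h] that(2) ij x by (intro step) auto
    then have "hd (factor W (i + h) (Suc r)) = hd (factor W (j + h) (Suc r))" by simp
    then show ?thesis using x that(2) ij eW by (simp add: factor_def hd_drop_conv_nth add.commute)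
  qed
  moreover have "i + (j - i) < s + n" "0 < j - i" using ij by auto
  ultimately show ?thesis using ij(1) by blast
qed

text \<open>Three powers arise from a beginning shorter than \<open>n\<close>, a power of the period and an incomplete last
  period. An interval of at most \<open>T\<close> positions is instead halved into two short words.\<close>

lemma power_product_low_complexity:
  assumes "W \<in> lists A" "s \<le> e" "e \<le> length W" "n > 0" "n \<le> Suc T" "T \<le> 2 * (n - 1)"
    and few: "s + T < e \<Longrightarrow> card ((\<lambda>i. factor W i T) ` {s..<e}) < n"
  shows "power_product (short_words A n) 3 (factor W s (e - s))"
proof (cases "s + T < e")
  case False
  then show ?thesis
    using assms(2-6) factor_in_lists[OF assms(1)]
    by (intro power_product_mono[OF power_product_two, of _ A n 3]) (simp_all add: length_factor)
next
  case True
  from low_complexity_periodic[OF few[OF True] assms(5) True assms(3)] obtain i g where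
    ig: "s \<le> i" "i + g < s + n" "0 < g"
    and per: "\<And>x. i \<le> x \<Longrightarrow> x + g < e \<Longrightarrow> W ! x = W ! (x + g)" by blast
  have ie: "i \<le> e" using ig True assms(5) by linarith
  note A = factor_in_lists[OF assms(1)]
  let ?v = "factor W i (e - i)"
  have lv: "length ?v = e - i" using ie assms(3) by (simp add: length_factor)
  have "?v ! x = ?v ! (x + g)" if "x + g < length ?v" for x
    using that lv per[of "i + x"] ie assms(3) by (simp add: factor_def ac_simps)
  then have v: "power_product (short_words A n) 2 ?v"
    using ig by (intro power_product_periodic[OF A, of g]) auto
  have "length (factor W s (i - s)) < n" using ig ie assms(3) by (simp add: length_factor)
  then have "power_product (short_words A n) 1 (factor W s (i - s))"
    using A by (intro power_product_word) auto
  from power_product_append[OF this v]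
  have "power_product (short_words A n) 3 (factor W s (i - s) @ ?v)" by (simp add: numeral_3_eq_3)
  then show ?thesis using ig(1) ie by (simp only: factor_join)
qed

section \<open>The height\<close>

text \<open>Three powers for each interval between cuts; the positions where no full \<open>T\<close>-factor starts are the
  last \<open>T - 1\<close> letters, which two more short words cover.\<close>

lemma power_product_not_divisible:
  fixes W :: "'a::linorder list"
  assumes "\<not> n_divisible n W" "n > 0" "W \<in> lists A" "n \<le> Suc T" "T \<le> 2 * (n - 1)" "T > 0"
  shows "power_product (short_words A n) (6 * n * complexity W T + 5) W"
proof -
  define m where "m = Suc (length W) - T"
  obtain B where B: "finite B" "card B \<le> 2 * (n - 1) * complexity W T"
    "\<And>s e. e + T \<le> Suc (length W) \<Longrightarrow> s + T < e \<Longrightarrow> B \<inter> {s<..<e} = {} \<Longrightarrow>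
       card ((\<lambda>i. factor W i T) ` {s..<e}) < n"
    using cuts_exist[OF assms(1,2), of T] by blast
  have "power_product (short_words A n) (3 * (card (B \<inter> {0<..<m}) + 1)) (factor W 0 (m - 0))"
  proof (rule interval_cut_induct[OF B(1),
        where P = "\<lambda>s e k. power_product (short_words A n) (3 * k) (factor W s (e - s))"])
    fix s e assume "s \<le> e" "e \<le> m" "B \<inter> {s<..<e} = {}"
    then show "power_product (short_words A n) (3 * 1) (factor W s (e - s))"
      using power_product_low_complexity[OF assms(3) \<open>s \<le> e\<close> _ assms(2,4,5)] B(3) assms(6)
      by (simp add: m_def)
  next
    fix s b e x y
    assume sb: "s \<le> b" "b \<le> e" and
      "power_product (short_words A n) (3 * x) (factor W s (b - s))"
      "power_product (short_words A n) (3 * y) (factor W b (e - b))"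
    then have "power_product (short_words A n) (3 * x + 3 * y)
        (factor W s (b - s) @ factor W b (e - b))"
      by (intro power_product_append)
    then show "power_product (short_words A n) (3 * (x + y)) (factor W s (e - s))"
      using sb by (simp only: factor_join distrib_left)
  qed
  moreover have "power_product (short_words A n) 2 (drop m W)"
    using assms in_lists_take_drop[of W A m] by (intro power_product_two) (auto simp: m_def)
  ultimately have "power_product (short_words A n) (3 * (card (B \<inter> {0<..<m}) + 1) + 2)
      (factor W 0 (m - 0) @ drop m W)"
    by (rule power_product_append)
  then have "power_product (short_words A n) (3 * (card (B \<inter> {0<..<m}) + 1) + 2) W"
    by (simp add: factor_def)
  moreover have "card (B \<inter> {0<..<m}) \<le> 2 * (n * complexity W T)"
  proof -
    have "card (B \<inter> {0<..<m}) \<le> card B" using B(1) by (intro card_mono) auto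
    also note B(2)
    also have "2 * (n - 1) * complexity W T \<le> 2 * n * complexity W T"
      by (intro mult_right_mono) auto
    finally show ?thesis by simp
  qed
  ultimately show ?thesis by (elim power_product_mono) simp
qed

text \<open>Since \<open>n \<ge> 2\<close>, the factor \<open>2 n\<^sup>3\<close> is at most \<open>n\<^sup>4\<close>, and \<open>3\<^sup>k \<le> 4\<^sup>k = (2\<^sup>k)\<^sup>2 \<le> n\<^sup>2\<close> bounds \<open>k\<close> by
  \<open>2 log\<^sub>3 n\<close>. So the power of \<open>n\<close> is at most \<open>8 log\<^sub>3 n + 5\<close>, and \<open>E1\<close> exceeds \<open>6 + 5\<close>.\<close>

lemma height_estimate:
  assumes "n \<ge> 2" "l \<ge> 1" "2 ^ k < n"
  shows "real (6 * n * (l * (2 * n ^ 3) ^ Suc k) + 5) \<le> Phi n l"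
proof -
  have n: "real n \<ge> 2" "real n > 0" using assms(1) by auto
  have L: "log 3 (real n) \<ge> 0" "log 3 (4::real) \<ge> 0" using n by auto
  have k: "real k \<le> 2 * log 3 (real n)"
  proof -
    have "real (2 ^ k) \<le> real n" using assms(3) by (simp only: of_nat_le_iff)
    then have le: "(2::real) ^ k \<le> real n" by simp
    have "(3::real) ^ k \<le> 4 ^ k" by (intro power_mono) auto
    also have "\<dots> = (2 ^ k)\<^sup>2" by (simp add: power2_eq_square power_mult_distrib[symmetric])
    also have "\<dots> \<le> (real n)\<^sup>2" using le by (intro power_mono) auto
    finally have "log 3 (3 ^ k) \<le> log 3 ((real n)\<^sup>2)" using n by (subst log_le_cancel_iff) auto
    then show ?thesis using n by (simp add: log_nat_power)
  qed
  have "real n * (real l * (2 * real n ^ 3) ^ Suc k) \<le> real n * (real l * (real n * real n ^ 3) ^ Suc k)"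
    using n by (intro mult_left_mono power_mono mult_right_mono) auto
  also have "\<dots> = real l * real n ^ (4 * k + 5)"
    by (simp add: power_mult[symmetric] power_Suc[symmetric] power_add[symmetric] del: power_Suc)
      (simp add: power_add power_mult_distrib power_mult eval_nat_numeral)
  also have "real n ^ (4 * k + 5) = real n powr (4 * real k + 5)"
    using n powr_realpow[of "real n" "4 * k + 5"] by simp
  also have "\<dots> \<le> real n powr (E2 + 12 * log 3 (real n))"
  proof (rule powr_mono)
    show "4 * real k + 5 \<le> E2 + 12 * log 3 (real n)" using k L unfolding E2_def by linarith
  qed (use n in simp)
  finally have main: "real n * (real l * (2 * real n ^ 3) ^ Suc k)
      \<le> real l * real n powr (E2 + 12 * log 3 (real n))" using assms(2) by simp
  have "1 \<le> n * (l * (2 * n ^ 3) ^ Suc k)" using assms by simp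
  then have "6 * n * (l * (2 * n ^ 3) ^ Suc k) + 5 \<le> 11 * (n * (l * (2 * n ^ 3) ^ Suc k))"
    by simp
  then have "real (6 * n * (l * (2 * n ^ 3) ^ Suc k) + 5) \<le> real (11 * (n * (l * (2 * n ^ 3) ^ Suc k)))"
    by (rule of_nat_mono)
  also have "\<dots> = 11 * (real n * (real l * (2 * real n ^ 3) ^ Suc k))" by simp
  also have "\<dots> \<le> 11 * (real l * real n powr (E2 + 12 * log 3 (real n)))"
    by (intro mult_left_mono main) simp
  also have "\<dots> \<le> E1 * (real l * real n powr (E2 + 12 * log 3 (real n)))"
  proof (rule mult_right_mono)
    have "(11::real) \<le> 4 powr 2" by simp
    also have "\<dots> \<le> E1" unfolding E1_def using L by (intro powr_mono) auto
    finally show "11 \<le> E1" .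
  qed simp
  finally show ?thesis by (simp add: Phi_def mult.assoc)
qed

lemma height_bound_exists:
  fixes A :: "'a::linorder set"
  assumes "n \<ge> 1" "finite A" "card A \<ge> 1"
  shows "\<exists>H. (\<forall>W \<in> {W \<in> lists A. \<not> n_divisible n W}. power_product (short_words A n) H W) \<and>
    real H \<le> Phi n (card A)"
proof (cases "n = 1")
  case True
  \<comment> \<open>Every word is 1-divisible, so the bound is needed only for the empty set.\<close>
  have "n_divisible 1 W" for W :: "'a list"
    unfolding n_divisible_def by (intro exI[of _ "[]"] exI[of _ "[W]"]) simp
  then show ?thesis using True by (intro exI[of _ 0]) (auto simp: Phi_def E1_def)
next
  case False
  with assms(1) have n: "n \<ge> 2" by simp
  \<comment> \<open>All lengths that get doubled are at most \<open>n - 1\<close>, and the last doubling reaches at least \<open>n\<close>.\<close>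
  obtain k where k: "2 ^ k \<le> n - 1" "n - 1 < 2 ^ Suc k"
  proof -
    have "1 \<le> n - 1" using n by simp
    from ex_power_ivl1[OF order_refl this] that show thesis by auto
  qed
  define H where "H = 6 * n * (card A * (2 * n ^ 3) ^ Suc k) + 5"
  have "power_product (short_words A n) H W" if "W \<in> lists A" "\<not> n_divisible n W" for W
  proof (rule power_product_mono)
    show "power_product (short_words A n) (6 * n * complexity W (2 ^ Suc k) + 5) W"
      using that k n by (intro power_product_not_divisible) auto
    show "6 * n * complexity W (2 ^ Suc k) + 5 \<le> H"
      unfolding H_def using that k n assms(2)
      by (intro add_right_mono mult_left_mono complexity_power_of_two) auto
  qed
  moreover have "real H \<le> Phi n (card A)"
    unfolding H_def using n assms(3) k by (intro height_estimate) auto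
  ultimately show ?thesis by blast
qed

theorem theorem8:
  fixes n l :: nat and A :: "'a::linorder set"
  assumes "n \<ge> 1" and "l \<ge> 1"
    and "finite A" and "card A = l"
  shows "\<exists>h. has_height {W \<in> lists A. \<not> n_divisible n W} {u \<in> lists A. length u < n} h
             \<and> real h \<le> Phi n l"
proof -
  define P where "P h \<longleftrightarrow> (\<forall>W \<in> {W \<in> lists A. \<not> n_divisible n W}.
    power_product {u \<in> lists A. length u < n} h W)" for h
  from height_bound_exists[of n A] assms obtain H where H: "P H" "real H \<le> Phi n l"
    unfolding P_def by auto
  have "has_height {W \<in> lists A. \<not> n_divisible n W} {u \<in> lists A. length u < n} (Least P)"
    unfolding has_height_def P_def[symmetric] using LeastI[of P H] Least_le[of P] H(1) by blast
  moreover have "real (Least P) \<le> Phi n l"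
    using Least_le[of P H] H by (meson le_trans of_nat_mono order_trans)
  ultimately show ?thesis by blast
qed

end
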